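(* Let $\mathrm{sl}(2,\mathbb R)$ be the Lie algebra of real $2\times2$ matrices of trace zero, and set $$\mathcal M=\left\{\begin{pmatrix}0&a\\ b&0\end{pmatrix} : a,b\in\mathbb R\right\},\qquad \mathcal J_0=\left\{\begin{pmatrix}u&0\\ 0&-u\end{pmatrix} : u\in\mathbb R\right\}.$$ Then $(\mathrm{sl}(2,\mathbb R),\mathcal M,\mathcal J_0)$ is a differential Lie algebra of order $1$ (for a suitable identification of vector spaces $\mathcal M=W_1^0(V_1^0)$), and it is not fundamental.
   Context: Lie algebras are finite dimensional and real. **The spaces.** For finite dimensional real vector spaces $V_{-1},V_0$, put $V_1=\mathrm{Hom}(V_{-1},V_0)$ and for $j\ge 2$, $V_j=\{X\in\mathrm{Hom}(V_{-1},V_{j-1}) : X(u)(v)=X(v)(u)\ \text{for all } u,v\in V_{-1}\}$. For $k\ge 1$ and a linear subspace $V_k^0\subset V_k$ (possibly zero), let $W_k^0=W_k^0(V_k^0)=V_{-1}\oplus V_0\oplus\cdots\oplus V_{k-1}\oplus V_k^0$, with the natural bracket $[\,,\,]_0$ determined by $[X_p,X_{-1}]_0=-[X_{-1},X_p]_0=X_p(X_{-1})$ for $X_{-1}\in V_{-1}$ and $X_p\in V_p$ ($1\le p\le k-1$) or $X_p\in V_k^0$ ($p=k$), and zero for all other combinations of homogeneous elements. Put $D^p=V_p\oplus V_{p+1}\oplus\cdots\oplus V_k^0$ for $0\le p\le k$ (so $D^k=V_k^0$). **The Lie algebra $\mathcal A_k(W_k^0)$.** $\mathcal A_k(W_k^0)=\{X\in\mathrm{gl}(W_k^0)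 : X(V_{-1}\oplus V_k^0)\subset V_{-1}\oplus V_k^0,\ X(D^p)\subset D^p\ (0\le p\le k)\}$. For $S\in\mathrm{Hom}(W_k^0,\mathcal A_k(W_k^0))$ define $\partial S\in \mathrm{Hom}(W_k^0\wedge W_k^0,W_k^0)$ by $(\partial S)(X\wedge Y)=S(X)(Y)-S(Y)(X)$. **Differential Lie algebra.** Let $\mathcal J$ be a Lie algebra. $(\mathcal J,\mathcal M,\mathcal J_0)$ is a *differential Lie algebra* of order $k$ if: (1) $\mathcal J_0$ is a Lie subalgebra of $\mathcal J$ and $\mathcal M$ is a vector subspace with $\mathcal J=\mathcal M\oplus\mathcal J_0$; (2) for some $V_{-1},V_0$ and $V_k^0$ (subspaces of $\mathcal M$), $\mathcal M=W_k^0(V_k^0)$ (identified as vector spaces, with $V_k^0$ regarded as a subspace of $V_k$); (3) the linear map $\rho:\mathcal J_0\to\mathrm{gl}(\mathcal M)$, $\rho(X_0)(X)=$ the $\mathcal M$-component of $[X_0,X]$, takes values in $\mathcal A_k(W_k^0)$; (4) with $\alpha(X\wedge Y)=$ the $\mathcal M$-component of $[X,Y]$ for $X,Y\in\mathcal M$, there is $S\in\mathrm{Hom}(\mathcal M,\mathcal A_k(W_k^0))$ such that $\alpha(X\wedge Y)=[X,Y]_0+(\partial S)(X\wedge Y)$ for all $X,Y\in\mathcal M$. It is called *fundamental* if $\mathcal J_0=(0)$. *)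

theory Defs
  imports "HOL-Analysis.Analysis" "HOL-Library.Function_Algebras"
begin

instantiation "fun" :: (type, real_vector) real_vector
begin

definition scaleR_fun_def: "scaleR c f = (\<lambda>x. c *\<^sub>R f x)"

instance
  by standard (simp_all add: scaleR_fun_def fun_eq_iff scaleR_right_distrib scaleR_left_distrib)

end

definition linear_map_on :: "'a::real_vector set \<Rightarrow> ('a \<Rightarrow> 'b::real_vector) \<Rightarrow> bool" where
  "linear_map_on V f \<longleftrightarrow>
     (\<forall>x\<in>V. \<forall>y\<in>V. f (x + y) = f x + f y) \<and> (\<forall>c. \<forall>x\<in>V. f (c *\<^sub>R x) = c *\<^sub>R f x)"

text \<open>Linear maps are extended by \<open>0\<close> outside \<open>V\<close>, so that distinct elements of \<open>Hom V W\<close>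
  are distinct linear maps and \<open>Hom V W\<close> is itself a vector space under pointwise operations.\<close>

definition Hom :: "'a::real_vector set \<Rightarrow> 'b::real_vector set \<Rightarrow> ('a \<Rightarrow> 'b) set" where
  "Hom V W = {f. linear_map_on V f \<and> (\<forall>x\<in>V. f x \<in> W) \<and> (\<forall>x. x \<notin> V \<longrightarrow> f x = 0)}"

abbreviation gl :: "'a::real_vector set \<Rightarrow> ('a \<Rightarrow> 'a) set" where
  "gl V \<equiv> Hom V V"

text \<open>An element of $V_j$ is an iterated linear map taking \<open>j\<close> arguments from $V_{-1}$ to $V_0$. To
  have all $V_j$ inside one type it is encoded as a function on argument lists, supported on the
  lists of length \<open>j\<close>; \<open>app X u\<close> is the value $X(u) \in V_{j-1}$. In particular \<open>const0 v\<close> encodes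
  $v \in V_0$.\<close>

type_synonym ('a, 'b) multi = "'a list \<Rightarrow> 'b"

definition app :: "('a, 'b) multi \<Rightarrow> 'a \<Rightarrow> ('a, 'b) multi" where
  "app X u = (\<lambda>us. X (u # us))"

definition const0 :: "'b::zero \<Rightarrow> ('a, 'b) multi" where
  "const0 v = (\<lambda>us. if us = [] then v else 0)"

fun Vsp :: "'a::real_vector set \<Rightarrow> 'b::real_vector set \<Rightarrow> nat \<Rightarrow> ('a, 'b) multi set" where
  "Vsp Vm V0 0 = const0 ` V0"
| "Vsp Vm V0 (Suc 0) = {X. X [] = 0 \<and> app X \<in> Hom Vm (Vsp Vm V0 0)}"
| "Vsp Vm V0 (Suc (Suc j)) =
     {X. X [] = 0 \<and> app X \<in> Hom Vm (Vsp Vm V0 (Suc j)) \<and>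
         (\<forall>u\<in>Vm. \<forall>v\<in>Vm. app (app X u) v = app (app X v) u)}"

text \<open>The pair \<open>(x, F)\<close> is the element of the external direct sum whose component in $V_{-1}$
  is \<open>x\<close> and whose component of degree \<open>p \<ge> 0\<close> is \<open>F p\<close>.\<close>

type_synonym ('a, 'b) graded = "'a \<times> (nat \<Rightarrow> ('a, 'b) multi)"

definition Wsp :: "nat \<Rightarrow> 'a::real_vector set \<Rightarrow> 'b::real_vector set \<Rightarrow> ('a, 'b) multi set
    \<Rightarrow> ('a, 'b) graded set" where
  "Wsp k Vm V0 Vk0 =
     {(x, F). x \<in> Vm \<and> (\<forall>p<k. F p \<in> Vsp Vm V0 p) \<and> F k \<in> Vk0 \<and> (\<forall>p>k. F p = 0)}"

text \<open>For homogeneous arguments the formula below reduces to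
  $[X_p, X_{-1}]_0 = -[X_{-1}, X_p]_0 = X_p(X_{-1}) \in V_{p-1}$ for $p \ge 1$, and to \<open>0\<close> for all
  other combinations of degrees.\<close>

definition bracket0 :: "('a, 'b::real_vector) graded \<Rightarrow> ('a::real_vector, 'b) graded
    \<Rightarrow> ('a, 'b) graded" where
  "bracket0 X Y =
     (0, \<lambda>q. app (snd X (Suc q)) (fst Y) - app (snd Y (Suc q)) (fst X))"

definition Dsp :: "nat \<Rightarrow> 'a::real_vector set \<Rightarrow> 'b::real_vector set \<Rightarrow> ('a, 'b) multi set
    \<Rightarrow> nat \<Rightarrow> ('a, 'b) graded set" where
  "Dsp k Vm V0 Vk0 p = {(x, F) \<in> Wsp k Vm V0 Vk0. x = 0 \<and> (\<forall>q<p. F q = 0)}"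

text \<open>The subspace $V_{-1} \oplus V_k^0$ of $W_k^0$.\<close>

definition Esp :: "nat \<Rightarrow> 'a::real_vector set \<Rightarrow> 'b::real_vector set \<Rightarrow> ('a, 'b) multi set
    \<Rightarrow> ('a, 'b) graded set" where
  "Esp k Vm V0 Vk0 = {(x, F) \<in> Wsp k Vm V0 Vk0. \<forall>q<k. F q = 0}"

definition Alg :: "nat \<Rightarrow> 'a::real_vector set \<Rightarrow> 'b::real_vector set \<Rightarrow> ('a, 'b) multi set
    \<Rightarrow> (('a, 'b) graded \<Rightarrow> ('a, 'b) graded) set" where
  "Alg k Vm V0 Vk0 =
     {T \<in> gl (Wsp k Vm V0 Vk0).
        T ` Esp k Vm V0 Vk0 \<subseteq> Esp k Vm V0 Vk0 \<and>
        (\<forall>p\<le>k. T ` Dsp k Vm V0 Vk0 p \<subseteq> Dsp k Vm V0 Vk0 p)}"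

definition del :: "('w \<Rightarrow> 'w \<Rightarrow> 'w::minus) \<Rightarrow> 'w \<Rightarrow> 'w \<Rightarrow> 'w" where
  "del S X Y = S X Y - S Y X"

definition lie_algebra :: "'g::real_vector set \<Rightarrow> ('g \<Rightarrow> 'g \<Rightarrow> 'g) \<Rightarrow> bool" where
  "lie_algebra J br \<longleftrightarrow>
     subspace J \<and> (\<exists>B. finite B \<and> span B = J) \<and>
     (\<forall>x\<in>J. \<forall>y\<in>J. br x y \<in> J) \<and>
     (\<forall>x\<in>J. linear_map_on J (br x)) \<and>
     (\<forall>y\<in>J. linear_map_on J (\<lambda>x. br x y)) \<and>
     (\<forall>x\<in>J. br x x = 0) \<and>
     (\<forall>x\<in>J. \<forall>y\<in>J. \<forall>z\<in>J. br x (br y z) + br y (br z x) + br z (br x y) = 0)"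

definition lie_subalgebra :: "'g::real_vector set \<Rightarrow> 'g set \<Rightarrow> ('g \<Rightarrow> 'g \<Rightarrow> 'g) \<Rightarrow> bool" where
  "lie_subalgebra H J br \<longleftrightarrow> subspace H \<and> H \<subseteq> J \<and> (\<forall>x\<in>H. \<forall>y\<in>H. br x y \<in> H)"

definition direct_sum_of :: "'g::real_vector set \<Rightarrow> 'g set \<Rightarrow> 'g set \<Rightarrow> bool" where
  "direct_sum_of J M N \<longleftrightarrow>
     subspace M \<and> subspace N \<and> J = {m + n | m n. m \<in> M \<and> n \<in> N} \<and> M \<inter> N = {0}"

definition component :: "'g::real_vector set \<Rightarrow> 'g set \<Rightarrow> 'g \<Rightarrow> 'g" where
  "component M N x = (THE m. m \<in> M \<and> x - m \<in> N)"

text \<open>The identification $\mathcal M = W_k^0(V_k^0)$: a linear isomorphism \<open>\<phi>\<close> from the external direct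
  sum onto \<open>M\<close> that is the identity on the subspaces $V_{-1}$ and $V_0$ of \<open>M\<close>. Only
  $V_k^0$ is given as a subspace of $V_k$; the corresponding subspace of \<open>M\<close> is its image under \<open>\<phi>\<close>.\<close>

definition identification :: "nat \<Rightarrow> 'g::real_vector set \<Rightarrow> 'g set \<Rightarrow> 'g set \<Rightarrow> ('g, 'g) multi set
    \<Rightarrow> (('g, 'g) graded \<Rightarrow> 'g) \<Rightarrow> bool" where
  "identification k M Vm V0 Vk0 \<phi> \<longleftrightarrow>
     subspace Vm \<and> subspace V0 \<and> Vm \<subseteq> M \<and> V0 \<subseteq> M \<and>
     subspace Vk0 \<and> Vk0 \<subseteq> Vsp Vm V0 k \<and>
     linear_map_on (Wsp k Vm V0 Vk0) \<phi> \<and> bij_betw \<phi> (Wsp k Vm V0 Vk0) M \<and>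
     (\<forall>x\<in>Vm. \<phi> (x, 0) = x) \<and>
     (\<forall>v\<in>V0. \<phi> (0, (\<lambda>p. if p = 0 then const0 v else 0)) = v)"

text \<open>The endomorphism of \<open>W\<close> corresponding to the endomorphism \<open>f\<close> of \<open>M\<close> under \<open>\<phi>\<close>.\<close>

definition pull :: "'w::zero set \<Rightarrow> ('w \<Rightarrow> 'g) \<Rightarrow> ('g \<Rightarrow> 'g) \<Rightarrow> 'w \<Rightarrow> 'w" where
  "pull W \<phi> f = (\<lambda>X. if X \<in> W then inv_into W \<phi> (f (\<phi> X)) else 0)"

definition differential_lie_algebra ::
    "nat \<Rightarrow> 'g::real_vector set \<Rightarrow> ('g \<Rightarrow> 'g \<Rightarrow> 'g) \<Rightarrow> 'g set \<Rightarrow> 'g set \<Rightarrow> bool" where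
  "differential_lie_algebra k J br M J0 \<longleftrightarrow>
     1 \<le> k \<and> lie_algebra J br \<and> lie_subalgebra J0 J br \<and> direct_sum_of J M J0 \<and>
     (\<exists>Vm V0 Vk0 \<phi>.
        identification k M Vm V0 Vk0 \<phi> \<and>
        (\<forall>Z\<in>J0. pull (Wsp k Vm V0 Vk0) \<phi> (\<lambda>X. component M J0 (br Z X)) \<in> Alg k Vm V0 Vk0) \<and>
        (\<exists>S\<in>Hom (Wsp k Vm V0 Vk0) (Alg k Vm V0 Vk0).
           \<forall>X\<in>Wsp k Vm V0 Vk0. \<forall>Y\<in>Wsp k Vm V0 Vk0.
             component M J0 (br (\<phi> X) (\<phi> Y)) = \<phi> (bracket0 X Y + del S X Y)))"

definition fundamental_differential_lie_algebra ::
    "nat \<Rightarrow> 'g::real_vector set \<Rightarrow> ('g \<Rightarrow> 'g \<Rightarrow> 'g) \<Rightarrow> 'g set \<Rightarrow> 'g set \<Rightarrow> bool" where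
  "fundamental_differential_lie_algebra k J br M J0 \<longleftrightarrow>
     differential_lie_algebra k J br M J0 \<and> J0 = {0}"

definition commutator :: "real^'n^'n \<Rightarrow> real^'n^'n \<Rightarrow> real^'n^'n" where
  "commutator A B = A ** B - B ** A"

definition sl2 :: "(real^2^2) set" where
  "sl2 = {A. trace A = 0}"

definition sl2_M :: "(real^2^2) set" where
  "sl2_M = {vector [vector [0, a], vector [b, 0]] | a b. True}"

definition sl2_J0 :: "(real^2^2) set" where
  "sl2_J0 = {vector [vector [u, 0], vector [0, - u]] | u. True}"

end

theory Submission
  imports Defs
begin

text \<open>Write \<open>\<M> = V\<^sub>-\<^sub>1 \<oplus> V\<^sub>0\<close> with \<open>V\<^sub>-\<^sub>1\<close> the strictly upper and \<open>V\<^sub>0\<close> the strictly lower triangular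
  matrices, and take \<open>V\<^sub>1\<^sup>0 = 0\<close>. Diagonal matrices act on \<open>\<M>\<close> preserving both summands, so \<open>\<rho>\<close> takes
  values in \<open>\<A>\<^sub>1\<close>. The bracket of two elements of \<open>\<M>\<close> is diagonal, so \<open>\<alpha> = 0\<close>; since
  \<open>V\<^sub>1\<^sup>0 = 0\<close>, also the natural bracket vanishes, and \<open>S = 0\<close> works.\<close>

text \<open>Two candidates for the definite description in \<open>component\<close> differ by an
  element of both summands, hence by 0. With uniqueness settled, any decomposition found by hand
  computes the component.\<close>

lemma component_add:
  assumes "direct_sum_of J M N" "m \<in> M" "n \<in> N"
  shows "component M N (m + n) = m"
  unfolding component_def
proof (rule the_equality)
  show "m \<in> M \<and> m + n - m \<in> N" using assms by simp
next
  fix m' assume m': "m' \<in> M \<and> m + n - m' \<in> N"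
  have sub: "subspace M" "subspace N" and int: "M \<inter> N = {0}"
    using assms(1) by (auto simp: direct_sum_of_def)
  have "m + n - m' - n \<in> N" using m' assms(3) sub(2) by (blast intro: subspace_diff)
  then have "m - m' \<in> N" by (simp add: algebra_simps)
  moreover have "m - m' \<in> M" using m' assms(2) sub(1) by (blast intro: subspace_diff)
  ultimately show "m' = m" using int by (metis IntI eq_iff_diff_eq_0 singletonD)
qed

section \<open>Order one with \<open>V\<^sub>1\<^sup>0 = 0\<close>\<close>

text \<open>This is the expression by which \<open>identification\<close> embeds \<open>V0\<close>,
  so that condition can be folded into it.\<close>

definition degree0 :: "'b::real_vector \<Rightarrow> nat \<Rightarrow> ('a, 'b) multi" where
  "degree0 v = (\<lambda>p. if p = 0 then const0 v else 0)"

lemma degree0_simps [simp]: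
  "degree0 v 0 = const0 v" "degree0 v (Suc p) = 0" "p > 0 \<Longrightarrow> degree0 v p = 0" "degree0 0 = 0"
  "const0 v [] = v" "const0 v = 0 \<longleftrightarrow> v = 0"
  by (auto simp: degree0_def const0_def fun_eq_iff)

lemma degree0_add: "degree0 (v + w) = degree0 v + degree0 w"
  by (auto simp: degree0_def const0_def fun_eq_iff)

lemma degree0_scaleR: "degree0 (c *\<^sub>R v) = c *\<^sub>R degree0 v"
  by (auto simp: degree0_def const0_def fun_eq_iff scaleR_fun_def)

text \<open>Degree 1 is confined to \<open>{0}\<close> and all higher degrees vanish in
  \<open>Wsp\<close>, so a pair of vectors gives coordinates on the whole space.\<close>

lemma Wsp_1_zero: "Wsp (Suc 0) Vm V0 {0} = {(x, degree0 v) | x v. x \<in> Vm \<and> v \<in> V0}"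
proof (intro set_eqI iffI)
  fix X assume "X \<in> Wsp (Suc 0) Vm V0 {0}"
  then obtain x F v where X: "X = (x, F)" "x \<in> Vm" "F 0 = const0 v" "v \<in> V0" "F (Suc 0) = 0"
    "\<forall>p>Suc 0. F p = 0"
    by (auto simp: Wsp_def)
  have "F p = degree0 v p" for p
    using X(3,5,6) by (cases "p = 0"; cases "p = Suc 0") auto
  then show "X \<in> {(x, degree0 v) | x v. x \<in> Vm \<and> v \<in> V0}"
    using X by blast
qed (auto simp: Wsp_def)

lemma Esp_1_zero:
  assumes "subspace V0"
  shows "Esp (Suc 0) Vm V0 {0} = {(x, 0) | x. x \<in> Vm}"
  using subspace_0[OF assms] unfolding Esp_def Wsp_1_zero
  by (auto intro: exI[of _ 0])

lemma Dsp_1_zero_0: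
  assumes "subspace Vm"
  shows "Dsp (Suc 0) Vm V0 {0} 0 = {(0, degree0 v) | v. v \<in> V0}"
  using subspace_0[OF assms] unfolding Dsp_def Wsp_1_zero by auto

lemma Dsp_1_zero_1:
  assumes "subspace Vm" "subspace V0"
  shows "Dsp (Suc 0) Vm V0 {0} (Suc 0) = {0}"
  using subspace_0[OF assms(1)] subspace_0[OF assms(2)] unfolding Dsp_def Wsp_1_zero
  by (auto simp: zero_prod_def intro: exI[of _ 0])

text \<open>Here \<open>Esp\<close> is the summand \<open>Vm\<close>, while \<open>Dsp\<close> is
  \<open>V0\<close> in degree 0 and trivial in degree 1. Block diagonal maps therefore satisfy every
  invariance condition; \<open>T0\<close> supplies the extension by 0 that \<open>Hom\<close>
  demands.\<close>

lemma Alg_1_zero_I: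
  assumes "subspace Vm" "subspace V0"
    and T: "\<And>x v. x \<in> Vm \<Longrightarrow> v \<in> V0 \<Longrightarrow> T (x, degree0 v) = (f x, degree0 (g v))"
    and T0: "\<And>X. X \<notin> Wsp (Suc 0) Vm V0 {0} \<Longrightarrow> T X = 0"
    and f: "linear_map_on Vm f" "\<And>x. x \<in> Vm \<Longrightarrow> f x \<in> Vm"
    and g: "linear_map_on V0 g" "\<And>v. v \<in> V0 \<Longrightarrow> g v \<in> V0"
  shows "T \<in> Alg (Suc 0) Vm V0 {0}"
proof -
  have z: "0 \<in> Vm" "0 \<in> V0" using assms by (auto simp: subspace_0)
  \<comment> \<open>Scaling the vector 0 by the scalar 0 stays inside the sets on which
    \<open>f\<close> and \<open>g\<close> are linear.\<close>
  have fg0: "f 0 = 0" "g 0 = 0"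
    using f(1) g(1) z by (metis linear_map_on_def scaleR_zero_left)+
  have Tx: "T (x, 0) = (f x, 0)" if "x \<in> Vm" for x
    using T[OF that z(2)] fg0 by simp
  have Tv: "T (0, degree0 v) = (0, degree0 (g v))" if "v \<in> V0" for v
    using T[OF z(1) that] fg0 by simp
  have "linear_map_on (Wsp (Suc 0) Vm V0 {0}) T"
    unfolding linear_map_on_def
  proof (intro conjI ballI allI)
    fix X Y assume "X \<in> Wsp (Suc 0) Vm V0 {0}" "Y \<in> Wsp (Suc 0) Vm V0 {0}"
    then obtain x v y w where "X = (x, degree0 v)" "Y = (y, degree0 w)" "x \<in> Vm" "v \<in> V0"
      "y \<in> Vm" "w \<in> V0"
      by (auto simp: Wsp_1_zero)
    then show "T (X + Y) = T X + T Y"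
      using T[of "x + y" "v + w"] T[of x v] T[of y w] assms(1,2) f(1) g(1)
      by (simp add: subspace_add linear_map_on_def degree0_add)
  next
    fix c X assume "X \<in> Wsp (Suc 0) Vm V0 {0}"
    then obtain x v where "X = (x, degree0 v)" "x \<in> Vm" "v \<in> V0"
      by (auto simp: Wsp_1_zero)
    then show "T (c *\<^sub>R X) = c *\<^sub>R T X"
      using T[of "c *\<^sub>R x" "c *\<^sub>R v"] T[of x v] assms(1,2) f(1) g(1)
      by (simp add: subspace_scale linear_map_on_def degree0_scaleR)
  qed
  moreover have "T X \<in> Wsp (Suc 0) Vm V0 {0}" if "X \<in> Wsp (Suc 0) Vm V0 {0}" for X
    using that T f(2) g(2) by (auto simp: Wsp_1_zero) blast
  moreover have "T ` Esp (Suc 0) Vm V0 {0} \<subseteq> Esp (Suc 0) Vm V0 {0}"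
    using Tx f(2) by (auto simp: Esp_1_zero[OF assms(2)])
  moreover have "T ` Dsp (Suc 0) Vm V0 {0} p \<subseteq> Dsp (Suc 0) Vm V0 {0} p" if "p \<le> Suc 0" for p
  proof (cases "p = 0")
    case True
    then show ?thesis using Tv g(2) by (auto simp: Dsp_1_zero_0[OF assms(1)])
  next
    case False
    then have "p = Suc 0" using that by simp
    then show ?thesis using Tx[OF z(1)] fg0 by (simp add: Dsp_1_zero_1[OF assms(1,2)] zero_prod_def)
  qed
  ultimately show ?thesis using T0 by (auto simp: Alg_def Hom_def)
qed

section \<open>A criterion for order one\<close>

lemma linear_map_on_subset: "linear_map_on V f \<Longrightarrow> U \<subseteq> V \<Longrightarrow> linear_map_on U f"
  unfolding linear_map_on_def by blast

text \<open>The bracket hypotheses describe a symmetric pair whose complement \<open>M\<close>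
  splits into two subspaces invariant under \<open>J0\<close>.\<close>

lemma differential_lie_algebra_1I:
  assumes J: "lie_algebra J br" and J0: "lie_subalgebra J0 J br"
    and JM: "direct_sum_of J M J0" and M: "direct_sum_of M Vm V0"
    and Vm: "\<And>Z x. Z \<in> J0 \<Longrightarrow> x \<in> Vm \<Longrightarrow> br Z x \<in> Vm"
    and V0: "\<And>Z x. Z \<in> J0 \<Longrightarrow> x \<in> V0 \<Longrightarrow> br Z x \<in> V0"
    and MM: "\<And>x y. x \<in> M \<Longrightarrow> y \<in> M \<Longrightarrow> br x y \<in> J0"
  shows "differential_lie_algebra 1 J br M J0"
proof -
  let ?W = "Wsp (Suc 0) Vm V0 {0}"
  \<comment> \<open>Evaluation at \<open>[]\<close> undoes \<open>const0\<close>. Ignoring higher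
    degrees does not spoil injectivity on \<open>?W\<close>, where they vanish.\<close>
  define \<phi> :: "('a, 'a) graded \<Rightarrow> 'a" where "\<phi> = (\<lambda>(x, F). x + F 0 [])"
  have \<phi>: "\<phi> (x, degree0 v) = x + v" for x v by (simp add: \<phi>_def)
  have sub: "subspace Vm" "subspace V0" "subspace M" "subspace J0"
    and MVV: "M = {m + n | m n. m \<in> Vm \<and> n \<in> V0}" and JMJ: "J = {m + n | m n. m \<in> M \<and> n \<in> J0}"
    using M JM by (auto simp: direct_sum_of_def)
  have z: "0 \<in> Vm" "0 \<in> V0" "0 \<in> M" "0 \<in> J0" using sub by (auto simp: subspace_0)
  have VM: "Vm \<subseteq> M" "V0 \<subseteq> M"
    using z unfolding MVV by (auto, metis add.right_neutral, metis add.left_neutral)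
  have "M \<subseteq> J" using z unfolding JMJ by (auto, metis add.right_neutral)
  have J0J: "J0 \<subseteq> J" using J0 by (simp add: lie_subalgebra_def)
  have inj: "inj_on \<phi> ?W"
  proof (rule inj_onI)
    fix X Y assume "X \<in> ?W" "Y \<in> ?W" and eq: "\<phi> X = \<phi> Y"
    then obtain x v y w where X: "X = (x, degree0 v)" "Y = (y, degree0 w)" "x \<in> Vm" "v \<in> V0"
      "y \<in> Vm" "w \<in> V0"
      by (auto simp: Wsp_1_zero)
    then have "x + v = y + w" using eq by (simp add: \<phi>)
    moreover from this have "x = y" using component_add[OF M] X by metis
    ultimately show "X = Y" using X by simp
  qed
  moreover have "\<phi> ` ?W = M"
    unfolding MVV Wsp_1_zero by (force simp: \<phi> image_def)
  ultimately have bij: "bij_betw \<phi> ?W M" by (simp add: bij_betw_def)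
  have "identification (Suc 0) M Vm V0 {0} \<phi>"
    unfolding identification_def
  proof (intro conjI)
    \<comment> \<open>Each value of \<open>app 0\<close> is the zero function, which is
      \<open>const0 0\<close>; hence the witness 0 in \<open>V0\<close>.\<close>
    show "{0} \<subseteq> Vsp Vm V0 (Suc 0)"
      using z by (auto simp: app_def Hom_def linear_map_on_def image_iff fun_eq_iff const0_def
          scaleR_fun_def intro!: bexI[of _ 0])
    show "linear_map_on ?W \<phi>"
      by (auto simp: linear_map_on_def \<phi>_def scaleR_fun_def algebra_simps)
    show "\<forall>v\<in>V0. \<phi> (0, \<lambda>p. if p = 0 then const0 v else 0) = v"
      using \<phi>[of 0] by (simp add: degree0_def)
  qed (use sub VM bij in \<open>auto simp: \<phi>_def subspace_def\<close>)
  moreover have "pull ?W \<phi> (\<lambda>X. component M J0 (br Z X)) \<in> Alg (Suc 0) Vm V0 {0}" if Z: "Z \<in> J0" for Z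
  proof (rule Alg_1_zero_I[OF sub(1,2), where f = "br Z" and g = "br Z"])
    have lin: "linear_map_on J (br Z)" using J J0J Z by (auto simp: lie_algebra_def)
    then show "linear_map_on Vm (br Z)" "linear_map_on V0 (br Z)"
      using VM \<open>M \<subseteq> J\<close> by (blast intro: linear_map_on_subset)+
    fix x v assume xv: "x \<in> Vm" "v \<in> V0"
    have "br Z (x + v) = br Z x + br Z v"
      using lin xv VM \<open>M \<subseteq> J\<close> unfolding linear_map_on_def by blast
    moreover have "br Z x + br Z v \<in> M"
      using Vm[OF Z xv(1)] V0[OF Z xv(2)] unfolding MVV by blast
    \<comment> \<open>Once the component is a value of \<phi> at a point of \<open>?W\<close>,
      injectivity cancels the \<open>inv_into\<close> in \<open>pull\<close>.\<close>
    ultimately have "component M J0 (br Z (\<phi> (x, degree0 v))) = \<phi> (br Z x, degree0 (br Z v))"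
      using component_add[OF JM _ z(4)] by (simp add: \<phi>)
    moreover have "(br Z x, degree0 (br Z v)) \<in> ?W" "(x, degree0 v) \<in> ?W"
      using Vm[OF Z xv(1)] V0[OF Z xv(2)] xv by (auto simp: Wsp_1_zero)
    ultimately show "pull ?W \<phi> (\<lambda>X. component M J0 (br Z X)) (x, degree0 v)
        = (br Z x, degree0 (br Z v))"
      using inj by (simp add: pull_def)
  qed (use Z Vm V0 in \<open>auto simp: pull_def\<close>)
  moreover have "(\<lambda>X. 0) \<in> Hom ?W (Alg (Suc 0) Vm V0 {0})"
  proof -
    have "(0 :: ('a, 'a) graded \<Rightarrow> ('a, 'a) graded) \<in> Alg (Suc 0) Vm V0 {0}"
      by (rule Alg_1_zero_I[OF sub(1,2), where f = "\<lambda>_. 0" and g = "\<lambda>_. 0"])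
        (use z in \<open>auto simp: linear_map_on_def zero_prod_def\<close>)
    then show ?thesis by (simp add: Hom_def linear_map_on_def)
  qed
  moreover have "component M J0 (br (\<phi> X) (\<phi> Y)) = \<phi> (bracket0 X Y + del (\<lambda>X. 0) X Y)"
    if "X \<in> ?W" "Y \<in> ?W" for X Y
  proof -
    have "br (\<phi> X) (\<phi> Y) \<in> J0" using that bij MM by (auto simp: bij_betw_def)
    then have "component M J0 (br (\<phi> X) (\<phi> Y)) = 0" using component_add[OF JM z(3)] by force
    \<comment> \<open>\<open>bracket0\<close> reads only the components of degree at least 1, all
      zero here.\<close>
    moreover have "bracket0 X Y = 0"
      using that by (auto simp: Wsp_1_zero bracket0_def app_def zero_prod_def fun_eq_iff)
    ultimately show ?thesis by (simp add: del_def \<phi>_def zero_prod_def)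
  qed
  ultimately show ?thesis
    unfolding differential_lie_algebra_def One_nat_def using J J0 JM by blast
qed

section \<open>The matrices of trace zero\<close>

lemma matrix_2_eq_iff:
  "(A :: real^2^2) = B \<longleftrightarrow> A$1$1 = B$1$1 \<and> A$1$2 = B$1$2 \<and> A$2$1 = B$2$1 \<and> A$2$2 = B$2$2"
  by (auto simp: vec_eq_iff forall_2)

lemma sl2_iff: "A \<in> sl2 \<longleftrightarrow> A$2$2 = - A$1$1"
  by (auto simp: sl2_def trace_def sum_2)

lemma sl2_M_iff: "A \<in> sl2_M \<longleftrightarrow> A$1$1 = 0 \<and> A$2$2 = 0"
  by (auto simp: sl2_M_def matrix_2_eq_iff)

lemma sl2_J0_iff: "A \<in> sl2_J0 \<longleftrightarrow> A$1$2 = 0 \<and> A$2$1 = 0 \<and> A$2$2 = - A$1$1"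
  by (auto simp: sl2_J0_def matrix_2_eq_iff)

lemma commutator_2_nth:
  fixes A B :: "real^2^2"
  shows "commutator A B $ i $ j = A$i$1 * B$1$j + A$i$2 * B$2$j - (B$i$1 * A$1$j + B$i$2 * A$2$j)"
  by (simp add: commutator_def matrix_matrix_mult_def sum_2)

lemma lie_algebra_sl2: "lie_algebra sl2 commutator"
proof -
  have "subspace sl2" by (auto simp: subspace_def sl2_iff)
  \<comment> \<open>A basis is independent in a Euclidean space, hence finite.\<close>
  moreover from this have "\<exists>B. finite B \<and> span B = sl2"
    by (metis basis_exists finiteI_independent span_subspace)
  moreover have "commutator x y \<in> sl2" for x y :: "real^2^2"
    by (simp add: sl2_iff commutator_2_nth)
  moreover have "linear_map_on sl2 (commutator x)" "linear_map_on sl2 (\<lambda>x. commutator x y)"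
    "commutator x x = 0" for x y :: "real^2^2"
    by (simp_all add: linear_map_on_def matrix_2_eq_iff commutator_2_nth algebra_simps)
  moreover have "commutator x (commutator y z) + commutator y (commutator z x)
      + commutator z (commutator x y) = 0" for x y z :: "real^2^2"
    by (simp add: matrix_2_eq_iff commutator_2_nth) (simp add: algebra_simps)
  ultimately show ?thesis
    unfolding lie_algebra_def by blast
qed

text \<open>A root space: bracketing with the diagonal matrix of entries u, -u multiplies it by 2u,
  and \<open>strict_lower2\<close> by -2u. Both are thus invariant under
  \<open>sl2_J0\<close>.\<close>

definition strict_upper2 :: "(real^2^2) set" where
  "strict_upper2 = {A. A$1$1 = 0 \<and> A$2$1 = 0 \<and> A$2$2 = 0}"

definition strict_lower2 :: "(real^2^2) set" where
  "strict_lower2 = {A. A$1$1 = 0 \<and> A$1$2 = 0 \<and> A$2$2 = 0}"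

lemma strict_upper2_iff: "A \<in> strict_upper2 \<longleftrightarrow> A$1$1 = 0 \<and> A$2$1 = 0 \<and> A$2$2 = 0"
  by (simp add: strict_upper2_def)

lemma strict_lower2_iff: "A \<in> strict_lower2 \<longleftrightarrow> A$1$1 = 0 \<and> A$1$2 = 0 \<and> A$2$2 = 0"
  by (simp add: strict_lower2_def)

lemma direct_sum_sl2: "direct_sum_of sl2 sl2_M sl2_J0"
proof -
  have "\<exists>m n. A = m + n \<and> m \<in> sl2_M \<and> n \<in> sl2_J0" if "A \<in> sl2" for A
    using that
    by (intro exI[of _ "vector [vector [0, A$1$2], vector [A$2$1, 0]]"]
        exI[of _ "vector [vector [A$1$1, 0], vector [0, - A$1$1]]"])
      (simp add: sl2_iff sl2_M_iff sl2_J0_iff matrix_2_eq_iff)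
  moreover have "sl2_M \<inter> sl2_J0 = {0}"
    by (auto simp: sl2_M_iff sl2_J0_iff matrix_2_eq_iff)
  ultimately show ?thesis
    by (auto simp: direct_sum_of_def subspace_def sl2_iff sl2_M_iff sl2_J0_iff)
qed

lemma direct_sum_sl2_M: "direct_sum_of sl2_M strict_upper2 strict_lower2"
proof -
  have "\<exists>m n. A = m + n \<and> m \<in> strict_upper2 \<and> n \<in> strict_lower2" if "A \<in> sl2_M" for A
    using that
    by (intro exI[of _ "vector [vector [0, A$1$2], vector [0, 0]]"]
        exI[of _ "vector [vector [0, 0], vector [A$2$1, 0]]"])
      (simp add: sl2_M_iff strict_upper2_iff strict_lower2_iff matrix_2_eq_iff)
  moreover have "strict_upper2 \<inter> strict_lower2 = {0}"
    by (auto simp: strict_upper2_iff strict_lower2_iff matrix_2_eq_iff)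
  ultimately show ?thesis
    by (auto simp: direct_sum_of_def subspace_def sl2_M_iff strict_upper2_iff strict_lower2_iff)
qed

theorem mainTheorem4:
  shows "differential_lie_algebra 1 sl2 commutator sl2_M sl2_J0 \<and>
    \<not> fundamental_differential_lie_algebra 1 sl2 commutator sl2_M sl2_J0"
proof
  have "lie_subalgebra sl2_J0 sl2 commutator"
    by (auto simp: lie_subalgebra_def subspace_def sl2_J0_iff sl2_iff commutator_2_nth)
  \<comment> \<open>Besides the invariance of the root spaces, the criterion asks that
    \<open>M\<close> bracket into \<open>J0\<close>: a product of two off-diagonal matrices is
    diagonal, and a commutator has trace 0.\<close>
  then show "differential_lie_algebra 1 sl2 commutator sl2_M sl2_J0"
    by (rule differential_lie_algebra_1I[OF lie_algebra_sl2 _ direct_sum_sl2 direct_sum_sl2_M])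
      (auto simp: sl2_J0_iff sl2_M_iff strict_upper2_iff strict_lower2_iff commutator_2_nth)
  \<comment> \<open>The element with u = 1 shows that \<open>sl2_J0\<close> is not
    \<open>{0}\<close>.\<close>
  have "vector [vector [1, 0], vector [0, - 1]] \<in> sl2_J0" by (simp add: sl2_J0_iff)
  moreover have "vector [vector [1, 0], vector [0, - 1]] \<noteq> (0 :: real^2^2)"
    by (simp add: matrix_2_eq_iff)
  ultimately show "\<not> fundamental_differential_lie_algebra 1 sl2 commutator sl2_M sl2_J0"
    by (auto simp: fundamental_differential_lie_algebra_def)
qed

end
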